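(* Let $X$ and $Y$ be metric spaces and let $f:X\to Y$ be a Lipschitz map. Then \[ \mathrm{t_DHD}(f(X))\le\mathrm{t_DHD}(X). \] So, if $f:X\to Y$ is bi-Lipschitz, then $\mathrm{t_DHD}(Y)=\mathrm{t_DHD}(X)$.
   Context: A map $f:X\to Y$ is bi-Lipschitz if it is a bijection and both $f$ and $f^{-1}$ are Lipschitz. $\mathrm{Ind}$ is the large inductive dimension, with $\mathrm{Ind}(\emptyset)=-1$. Values of $D$ and $\mathrm{t_DHD}$ lie in $\{-1\}\cup\mathbf{Ord}\cup\{\Omega\}$, ordered so that $-1<\alpha<\Omega$ for every ordinal $\alpha$. For an ordinal $\alpha$, $\lambda(\alpha)$ is the largest limit ordinal $\le\alpha$ ($0$ if there is none), and $n(\alpha)<\omega_0$ is the finite part: $\alpha=\lambda(\alpha)+n(\alpha)$. $D$-dimension (Henderson). $D(\emptyset)=-1$. For a nonempty metrizable space $X$, $D(X)$ is the smallest ordinal $\beta$, if any exists, such that $X=\bigcup\{A_\alpha:0\le\alpha\le\lambda(\beta)\}$ where: (i) each $A_\alpha$ is a closed subset of $X$ that is finite dimensional with respect to $\mathrm{Ind}$; (ii) for each $\delta$, $\bigcup\{A_\alpha:\delta\le\alpha\le\lambda(\beta)\}$ is closed in $X$; (iii) $n(\beta)=\mathrm{Ind}(A_{\lambda(\beta)})$, where $n(\beta)=0$ if $A_{\lambda(\beta)}=\emptyset$; (iv) for each $x\in X$ there is a largest $\delta\le\lambda(\beta)$ with $x\in A_\delta$. If no such $\beta$ exists, $D(X)=\Omega$.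 $D$-variant of transfinite Hausdorff dimension. For a metric space $X$, let $\mathcal L(X)$ be the collection of all Lipschitz maps $f:E\to Y$, where $E$ is a metric subspace of $X$ and $Y$ is any metric space; $\mathrm{Im}(f)=f(E)$. Then $\mathrm{t_DHD}(X)=\sup\{D(\mathrm{Im}(f)):f\in\mathcal L(X)\}$, set equal to $\Omega$ if there is no ordinal supremum; $\mathrm{t_DHD}(X)=-1$ if and only if $X=\emptyset$. *)

theory Defs
  imports "HOL-Analysis.Analysis"
begin

section \<open>Ordinals\<close>

text \<open>
  HOL has no type of all ordinals. The type \<open>'u ordinal\<close> consists of the order types of all
  well-orders on subsets of \<open>'u\<close>, i.e. of all ordinals of cardinality at most \<open>|'u|\<close>; it is an
  initial segment of the ordinals.
\<close>

quotient_type 'u ordinal = "'u rel" / partial: "\<lambda>r s. (r, s) \<in> ordIso"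
proof (rule part_equivpI)
  show "\<exists>r :: 'u rel. (r, r) \<in> ordIso"
    using ordIso_reflexive[of "{} :: 'u rel"] by (auto simp: well_order_on_empty)
  show "symp (\<lambda>r s :: 'u rel. (r, s) \<in> ordIso)"
    by (auto intro!: sympI ordIso_symmetric)
  show "transp (\<lambda>r s :: 'u rel. (r, s) \<in> ordIso)"
    by (auto intro!: transpI intro: ordIso_transitive)
qed

lemma ordIso_self_iff: "(r, r) \<in> ordIso \<longleftrightarrow> Well_order r"
  using ordIso_reflexive by (auto simp: ordIso_def)

lemma abs_rep_ordinal: "abs_ordinal (rep_ordinal x) = x"
  by (rule Quotient3_abs_rep[OF Quotient3_ordinal])

lemma Well_order_rep_ordinal: "Well_order (rep_ordinal x)"
  by (rule Quotient3_rep_reflp[OF Quotient3_ordinal, unfolded ordIso_self_iff])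

instantiation ordinal :: (type) wellorder
begin

lift_definition less_eq_ordinal :: "'a ordinal \<Rightarrow> 'a ordinal \<Rightarrow> bool"
  is "\<lambda>r s. (r, s) \<in> ordLeq"
  by (meson ordIso_ordLeq_trans ordIso_symmetric ordLeq_ordIso_trans)

lift_definition less_ordinal :: "'a ordinal \<Rightarrow> 'a ordinal \<Rightarrow> bool"
  is "\<lambda>r s. (r, s) \<in> ordLess"
  by (meson ordIso_ordLess_trans ordIso_symmetric ordLess_ordIso_trans)

instance
proof
  fix x y z :: "'a ordinal"
  show "x < y \<longleftrightarrow> x \<le> y \<and> \<not> y \<le> x"
    by transfer (metis ordIso_self_iff not_ordLeq_iff_ordLess ordLess_imp_ordLeq)
  show "x \<le> x"
    by transfer (metis ordIso_self_iff ordLeq_reflexive)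
  show "x \<le> y \<Longrightarrow> y \<le> z \<Longrightarrow> x \<le> z"
    by transfer (rule ordLeq_transitive)
  show "x \<le> y \<Longrightarrow> y \<le> x \<Longrightarrow> x = y"
    by transfer (simp add: ordIso_iff_ordLeq)
  show "x \<le> y \<or> y \<le> x"
    by transfer (metis ordIso_self_iff ordLeq_total)
next
  fix P :: "'a ordinal \<Rightarrow> bool" and a :: "'a ordinal"
  assume step: "\<And>x. (\<And>y. y < x \<Longrightarrow> P y) \<Longrightarrow> P x"
  have "Well_order r \<longrightarrow> P (abs_ordinal r)" for r
  proof (induction r rule: wf_induct[OF wf_ordLess])
    case (1 r)
    show ?case
    proof
      assume wr: "Well_order r"
      show "P (abs_ordinal r)"
      proof (rule step)
        fix y :: "'a ordinal" assume less: "y < abs_ordinal r"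
        have ry: "Well_order (rep_ordinal y)" and y: "abs_ordinal (rep_ordinal y) = y"
          by (rule Well_order_rep_ordinal, rule abs_rep_ordinal)
        have "(rep_ordinal y, r) \<in> ordLess"
          using less less_ordinal.abs_eq[of "rep_ordinal y" r] wr ry y by (simp add: ordIso_self_iff)
        with 1 ry y show "P y" by auto
      qed
    qed
  qed
  moreover have "Well_order (rep_ordinal a)" "abs_ordinal (rep_ordinal a) = a"
    by (rule Well_order_rep_ordinal, rule abs_rep_ordinal)
  ultimately show "P a" by metis
qed

end

text \<open>
  Below, an element \<open>\<alpha>\<close> of a well-ordered type stands for the ordinal that is the order type of
  \<open>{\<gamma>. \<gamma> < \<alpha>}\<close>.
\<close>

definition limit_ordinal :: "'o::wellorder \<Rightarrow> bool" where
  "limit_ordinal \<alpha> \<longleftrightarrow> (\<exists>\<gamma>. \<gamma> < \<alpha>) \<and> (\<forall>\<gamma><\<alpha>. \<exists>\<delta>. \<gamma> < \<delta> \<and> \<delta> < \<alpha>)"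

definition limit_part :: "'o::wellorder \<Rightarrow> 'o" where
  "limit_part \<alpha> =
     (if \<exists>\<gamma>\<le>\<alpha>. limit_ordinal \<gamma> then (GREATEST \<gamma>. \<gamma> \<le> \<alpha> \<and> limit_ordinal \<gamma>)
      else (LEAST \<gamma>. True))"

text \<open>The interval \<open>[\<lambda>(\<alpha>), \<alpha>)\<close> is finite and has order type \<open>n\<close> for \<open>\<alpha> = \<lambda>(\<alpha>) + n\<close>.\<close>

definition finite_part :: "'o::wellorder \<Rightarrow> nat" where
  "finite_part \<alpha> = card {limit_part \<alpha>..<\<alpha>}"

text \<open>The range of values: \<open>-1\<close>, the ordinals, and \<open>\<Omega>\<close>.\<close>

datatype 'o tdim = Minus_One | Ord 'o | Omega

instantiation tdim :: (wellorder) wellorder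
begin

fun less_eq_tdim :: "'a tdim \<Rightarrow> 'a tdim \<Rightarrow> bool" where
  "Minus_One \<le> _ \<longleftrightarrow> True"
| "Ord _ \<le> Minus_One \<longleftrightarrow> False"
| "Ord \<alpha> \<le> Ord \<beta> \<longleftrightarrow> \<alpha> \<le> \<beta>"
| "Ord _ \<le> Omega \<longleftrightarrow> True"
| "Omega \<le> d \<longleftrightarrow> d = Omega"

definition less_tdim :: "'a tdim \<Rightarrow> 'a tdim \<Rightarrow> bool" where
  "d < e \<longleftrightarrow> d \<le> e \<and> \<not> e \<le> (d :: 'a tdim)"

instance
proof
  fix x y z :: "'a tdim"
  show "x < y \<longleftrightarrow> x \<le> y \<and> \<not> y \<le> x" by (rule less_tdim_def)
  show "x \<le> x" by (cases x) auto
  show "x \<le> y \<Longrightarrow> y \<le> z \<Longrightarrow> x \<le> z" by (cases x; cases y; cases z) auto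
  show "x \<le> y \<Longrightarrow> y \<le> x \<Longrightarrow> x = y" by (cases x; cases y) auto
  show "x \<le> y \<or> y \<le> x" by (cases x; cases y) auto
next
  fix P :: "'a tdim \<Rightarrow> bool" and a :: "'a tdim"
  assume step: "\<And>x. (\<And>y. y < x \<Longrightarrow> P y) \<Longrightarrow> P x"
  have m: "P Minus_One"
  proof (rule step)
    fix y :: "'a tdim" show "y < Minus_One \<Longrightarrow> P y" by (simp add: less_tdim_def)
  qed
  have o: "P (Ord \<alpha>)" for \<alpha>
  proof (induction \<alpha> rule: less_induct)
    case (less \<alpha>)
    show ?case
    proof (rule step)
      fix y :: "'a tdim" show "y < Ord \<alpha> \<Longrightarrow> P y"
        using m less by (cases y) (auto simp: less_tdim_def)
    qed
  qed
  have "P Omega"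
  proof (rule step)
    fix y :: "'a tdim" show "y < Omega \<Longrightarrow> P y"
      using m o by (cases y) (auto simp: less_tdim_def)
  qed
  with m o show "P a" by (cases a) auto
qed

end

text \<open>
  The least upper bound; \<open>Omega\<close> if no ordinal (and not \<open>-1\<close>) bounds the set.
\<close>

definition tdim_sup :: "'o::wellorder tdim set \<Rightarrow> 'o tdim" where
  "tdim_sup S = (LEAST u. \<forall>d\<in>S. d \<le> u)"

lemma tdim_sup_upper: "d \<in> S \<Longrightarrow> d \<le> tdim_sup S"
proof -
  have "x \<le> Omega" for x :: "'a tdim" by (cases x) auto
  then have "\<forall>d\<in>S. d \<le> tdim_sup S" unfolding tdim_sup_def by (intro LeastI) blast
  then show "d \<in> S \<Longrightarrow> d \<le> tdim_sup S" by blast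
qed

lemma tdim_sup_least: "(\<And>d. d \<in> S \<Longrightarrow> d \<le> u) \<Longrightarrow> tdim_sup S \<le> u"
  unfolding tdim_sup_def by (rule Least_le) blast


section \<open>Large inductive dimension\<close>

text \<open>\<open>Ind_le X k\<close> is \<open>Ind X \<le> k\<close>, for an integer \<open>k \<ge> -1\<close>.\<close>

inductive Ind_le :: "'a topology \<Rightarrow> int \<Rightarrow> bool" where
  empty: "topspace X = {} \<Longrightarrow> k \<ge> -1 \<Longrightarrow> Ind_le X k"
| step: "k \<ge> 0 \<Longrightarrow>
    (\<forall>A V. closedin X A \<and> openin X V \<and> A \<subseteq> V \<longrightarrow>
       (\<exists>U. openin X U \<and> A \<subseteq> U \<and> U \<subseteq> V \<and> Ind_le (subtopology X (X frontier_of U)) (k - 1))) \<Longrightarrow>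
    Ind_le X k"

definition Ind :: "'a topology \<Rightarrow> ereal" where
  "Ind X = (INF k \<in> {k. Ind_le X k}. ereal (real_of_int k))"


section \<open>Henderson's dimension\<close>

text \<open>
  Conditions (i)--(iv) on a decomposition \<open>A\<close> of \<open>X\<close> indexed by \<open>\<alpha> \<le> \<lambda>(\<beta>)\<close>; the pieces may be
  empty (\<open>Ind {} = -1\<close>).
\<close>

definition D_decomposition :: "'a topology \<Rightarrow> 'o::wellorder \<Rightarrow> ('o \<Rightarrow> 'a set) \<Rightarrow> bool" where
  "D_decomposition X \<beta> A \<longleftrightarrow>
     topspace X = (\<Union>\<alpha>\<in>{..limit_part \<beta>}. A \<alpha>) \<and>
     (\<forall>\<alpha>\<le>limit_part \<beta>. closedin X (A \<alpha>) \<and> Ind (subtopology X (A \<alpha>)) < \<infinity>) \<and>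
     (\<forall>\<delta>. closedin X (\<Union>\<alpha>\<in>{\<delta>..limit_part \<beta>}. A \<alpha>)) \<and>
     (if A (limit_part \<beta>) = {} then finite_part \<beta> = 0
      else ereal (real (finite_part \<beta>)) = Ind (subtopology X (A (limit_part \<beta>)))) \<and>
     (\<forall>x\<in>topspace X. \<exists>\<delta>\<le>limit_part \<beta>. x \<in> A \<delta> \<and> (\<forall>\<alpha>\<le>limit_part \<beta>. x \<in> A \<alpha> \<longrightarrow> \<alpha> \<le> \<delta>))"

text \<open>
  The type \<open>'o\<close> of ordinals has to be large enough. If \<open>\<kappa> = max |X| \<aleph>\<^sub>0\<close>, then \<open>D X\<close> is \<open>\<Omega>\<close> or
  smaller than \<open>\<kappa>\<^sup>+\<close>: keep only those indices that are the largest \<open>\<delta>\<close> with \<open>x \<in> A \<delta>\<close> for some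
  point \<open>x\<close>, renumber them consecutively, and append empty pieces up to the next limit. Hence
  all ordinals below \<open>\<kappa>\<^sup>+\<close>, and also the ordinal \<open>\<kappa>\<^sup>+\<close> itself (which may be a supremum of such
  values), suffice.
\<close>

definition D_dim :: "'a topology \<Rightarrow> 'o::wellorder tdim" where
  "D_dim X =
     (if topspace X = {} then Minus_One
      else if \<exists>\<beta> :: 'o. \<exists>A. D_decomposition X \<beta> A
           then Ord (LEAST \<beta>. \<exists>A. D_decomposition X \<beta> A)
      else Omega)"


section \<open>The Lipschitz variant\<close>

text \<open>
  The targets \<open>Y\<close> range over the metric spaces with carrier in the type of points of \<open>X\<close>. This
  loses nothing, as a Lipschitz image of a subspace of \<open>X\<close> has at most as many points as \<open>X\<close>
  and so is isometric to such a \<open>Y\<close>; see \<open>D_dim_Lipschitz_image_le\<close> below, where the target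
  lives in an arbitrary type.
\<close>

definition t_DHD :: "'a metric \<Rightarrow> 'o::wellorder tdim" where
  "t_DHD X = tdim_sup
     {D_dim (mtopology_of (submetric Y (f ` E))) | E (Y :: 'a metric) f.
        E \<subseteq> mspace X \<and> Lipschitz_continuous_map (submetric X E) Y f}"

definition bi_Lipschitz_map :: "'a metric \<Rightarrow> 'b metric \<Rightarrow> ('a \<Rightarrow> 'b) \<Rightarrow> bool" where
  "bi_Lipschitz_map X Y f \<longleftrightarrow>
     bij_betw f (mspace X) (mspace Y) \<and>
     Lipschitz_continuous_map X Y f \<and>
     Lipschitz_continuous_map Y X (inv_into (mspace X) f)"

text \<open>
  Ordinals for comparing the dimensions of a space with points in \<open>'a\<close> and one with points in
  \<open>'b\<close>: \<open>|('a + 'b + nat) set| = 2 ^ |'a + 'b + nat|\<close> is at least \<open>\<kappa>\<^sup>+\<close> for each of the two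
  spaces, so the type contains every ordinal needed.
\<close>

type_synonym ('a, 'b) dim_ordinal = "('a + 'b + nat) set ordinal"


section \<open>Targets in arbitrary types\<close>

lemma Ind_le_homeomorphic:
  assumes "Ind_le X k" "homeomorphic_map X Y h"
  shows "Ind_le Y k"
  using assms
proof (induction arbitrary: Y)
  case (empty X k)
  then show ?case
    using homeomorphic_imp_surjective_map Ind_le.empty by fastforce
next
  case (step k X)
  show ?case
  proof (rule Ind_le.step[OF \<open>k \<ge> 0\<close>], intro allI impI, elim conjE)
    fix A V assume A: "closedin Y A" and V: "openin Y V" and AV: "A \<subseteq> V"
    note hom = \<open>homeomorphic_map X Y h\<close>
    obtain A' where A': "A' \<subseteq> topspace X" "A = h ` A'"
      using closedin_subset[OF A] homeomorphic_imp_surjective_map[OF hom]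
      by (metis subset_image_iff)
    obtain V' where V': "V' \<subseteq> topspace X" "V = h ` V'"
      using openin_subset[OF V] homeomorphic_imp_surjective_map[OF hom]
      by (metis subset_image_iff)
    have "closedin X A'" "openin X V'"
      using A V A' V' homeomorphic_map_closedness[OF hom] homeomorphic_map_openness[OF hom] by auto
    moreover have "A' \<subseteq> V'"
      using AV A' V' homeomorphic_imp_injective_map[OF hom] by (simp add: inj_on_image_subset_iff)
    ultimately have "closedin X A' \<and> openin X V' \<and> A' \<subseteq> V'" by blast
    from step.IH[rule_format, OF this] obtain U
      where U: "openin X U" "A' \<subseteq> U" "U \<subseteq> V'"
        and IH: "\<And>Z. homeomorphic_map (subtopology X (X frontier_of U)) Z h \<Longrightarrow> Ind_le Z (k - 1)"
      by auto
    have sub: "U \<subseteq> topspace X" using U openin_subset by blast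
    have "homeomorphic_map (subtopology X (X frontier_of U))
            (subtopology Y (Y frontier_of (h ` U))) h"
      using frontier_of_subset_topspace[of X U] frontier_of_subset_topspace[of Y "h ` U"]
      by (intro homeomorphic_map_subtopologies[OF hom])
        (simp add: inf.absorb2 homeomorphic_map_frontier_of[OF hom sub])
    then have "Ind_le (subtopology Y (Y frontier_of (h ` U))) (k - 1)" by (rule IH)
    moreover have "openin Y (h ` U)" using homeomorphic_map_openness[OF hom sub] U by blast
    ultimately show "\<exists>U. openin Y U \<and> A \<subseteq> U \<and> U \<subseteq> V \<and>
        Ind_le (subtopology Y (Y frontier_of U)) (k - 1)"
      using U A' V' by (intro exI[of _ "h ` U"]) auto
  qed
qed

lemma Ind_homeomorphic:
  assumes "homeomorphic_map X Y h"
  shows "Ind X = Ind Y"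
proof -
  obtain g where "homeomorphic_map Y X g"
    using assms by (metis homeomorphic_map_maps homeomorphic_maps_sym)
  then have "Ind_le X k \<longleftrightarrow> Ind_le Y k" for k
    using assms Ind_le_homeomorphic by metis
  then show ?thesis by (simp add: Ind_def)
qed

lemma D_decomposition_homeomorphic:
  assumes D: "D_decomposition X \<beta> A" and hom: "homeomorphic_map X Y h"
  shows "D_decomposition Y \<beta> (\<lambda>\<alpha>. h ` A \<alpha>)"
proof -
  let ?l = "limit_part \<beta>"
  have sub: "A \<alpha> \<subseteq> topspace X" if "\<alpha> \<le> ?l" for \<alpha>
    using D that unfolding D_decomposition_def by auto
  have Ind: "Ind (subtopology Y (h ` A \<alpha>)) = Ind (subtopology X (A \<alpha>))" if "\<alpha> \<le> ?l" for \<alpha>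
  proof -
    have "homeomorphic_map (subtopology X (A \<alpha>)) (subtopology Y (h ` A \<alpha>)) h"
      using sub[OF that] homeomorphic_imp_surjective_map[OF hom]
      by (intro homeomorphic_map_subtopologies[OF hom]) auto
    then show ?thesis by (simp add: Ind_homeomorphic)
  qed
  have inj: "inj_on h (topspace X)" and surj: "h ` topspace X = topspace Y"
    by (rule homeomorphic_imp_injective_map[OF hom], rule homeomorphic_imp_surjective_map[OF hom])
  have cl: "closedin Y (h ` S)" if "closedin X S" for S
    using that homeomorphic_map_closedness[OF hom] closedin_subset by blast
  have mem: "h x \<in> h ` A \<alpha> \<longleftrightarrow> x \<in> A \<alpha>" if "\<alpha> \<le> ?l" "x \<in> topspace X" for x \<alpha>
    using inj that sub by (meson inj_on_image_mem_iff)
  have "topspace Y = (\<Union>\<alpha>\<in>{..?l}. h ` A \<alpha>)"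
    using D surj unfolding D_decomposition_def by (metis image_UN)
  moreover have "\<forall>\<alpha>\<le>?l. closedin Y (h ` A \<alpha>) \<and> Ind (subtopology Y (h ` A \<alpha>)) < \<infinity>"
    using D cl Ind unfolding D_decomposition_def by simp
  moreover have "\<forall>\<delta>. closedin Y (\<Union>\<alpha>\<in>{\<delta>..?l}. h ` A \<alpha>)"
    using D cl unfolding D_decomposition_def by (metis image_UN)
  moreover have "if h ` A ?l = {} then finite_part \<beta> = 0
      else ereal (real (finite_part \<beta>)) = Ind (subtopology Y (h ` A ?l))"
    using D Ind unfolding D_decomposition_def by simp
  moreover have "\<forall>y\<in>topspace Y. \<exists>\<delta>\<le>?l. y \<in> h ` A \<delta> \<and> (\<forall>\<alpha>\<le>?l. y \<in> h ` A \<alpha> \<longrightarrow> \<alpha> \<le> \<delta>)"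
  proof
    fix y assume "y \<in> topspace Y"
    then obtain x where x: "x \<in> topspace X" "y = h x" using surj by blast
    then obtain \<delta> where "\<delta> \<le> ?l" "x \<in> A \<delta>" "\<forall>\<alpha>\<le>?l. x \<in> A \<alpha> \<longrightarrow> \<alpha> \<le> \<delta>"
      using D unfolding D_decomposition_def by blast
    then show "\<exists>\<delta>\<le>?l. y \<in> h ` A \<delta> \<and> (\<forall>\<alpha>\<le>?l. y \<in> h ` A \<alpha> \<longrightarrow> \<alpha> \<le> \<delta>)"
      using x mem by (intro exI[of _ \<delta>]) auto
  qed
  ultimately show ?thesis unfolding D_decomposition_def by blast
qed

lemma D_dim_homeomorphic:
  assumes "X homeomorphic_space Y"
  shows "D_dim X = (D_dim Y :: 'o::wellorder tdim)"
proof -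
  obtain h g where h: "homeomorphic_map X Y h" and g: "homeomorphic_map Y X g"
    using assms by (metis homeomorphic_space homeomorphic_space_sym)
  have "(\<exists>A. D_decomposition X \<beta> A) \<longleftrightarrow> (\<exists>A. D_decomposition Y \<beta> A)" for \<beta> :: 'o
    using D_decomposition_homeomorphic h g by metis
  moreover have "topspace X = {} \<longleftrightarrow> topspace Y = {}"
    using homeomorphic_imp_surjective_map[OF h] by (metis image_is_empty)
  ultimately show ?thesis unfolding D_dim_def by (simp only:)
qed

theorem D_dim_Lipschitz_image_le:
  fixes X :: "'a metric" and Y :: "'c metric"
  assumes E: "E \<subseteq> mspace X" and f: "Lipschitz_continuous_map (submetric X E) Y f"
  shows "D_dim (mtopology_of (submetric Y (f ` E))) \<le> (t_DHD X :: 'o::wellorder tdim)"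
proof -
  define g where "g = inv_into E f"
  define E' where "E' = g ` f ` E"
  define d where "d = (\<lambda>x y. mdist Y (f x) (f y))"
  have spE: "mspace (submetric X E) = E" using E by auto
  have fE: "f ` E \<subseteq> mspace Y" using f spE unfolding Lipschitz_continuous_map_def by auto
  have fg: "f (g y) = y" if "y \<in> f ` E" for y using that by (simp add: g_def f_inv_into_f)
  have E'E: "E' \<subseteq> E" unfolding E'_def g_def by (auto intro: inv_into_into)
  have inj: "inj_on f E'" unfolding E'_def inj_on_def using fg by auto
  interpret M: Metric_space E' d
  proof
    show "\<And>x y. 0 \<le> d x y" by (simp add: d_def)
    show "\<And>x y. d x y = d y x" by (simp add: d_def mdist_commute)
    show "d x y = 0 \<longleftrightarrow> x = y" if "x \<in> E'" "y \<in> E'" for x y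
      using that E'E fE inj unfolding d_def inj_on_def by (metis image_subset_iff mdist_zero subsetD)
    show "d x z \<le> d x y + d y z" if "x \<in> E'" "y \<in> E'" "z \<in> E'" for x y z
      using that E'E fE unfolding d_def by (intro mdist_triangle) auto
  qed
  define Z where "Z = metric (E', d)"
  have Z: "mspace Z = E'" "mdist Z = d" by (simp_all add: Z_def)
  have gE: "(g \<circ> f) ` E = E'" by (simp add: E'_def image_comp)
  have Lgf: "Lipschitz_continuous_map (submetric X E) Z (g \<circ> f)"
    using f spE gE fg unfolding Lipschitz_continuous_map_def Z by (auto simp: d_def)
  have "D_dim (mtopology_of (submetric Z ((g \<circ> f) ` E))) \<le> (t_DHD X :: 'o tdim)"
    unfolding t_DHD_def using E Lgf by (intro tdim_sup_upper) blast
  moreover have "submetric Z ((g \<circ> f) ` E) = Z"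
    using gE Z submetric_mspace by metis
  moreover have "mtopology_of Z homeomorphic_space mtopology_of (submetric Y (f ` E))"
  proof -
    have "Lipschitz_continuous_map Z (submetric Y (f ` E)) f"
      unfolding Lipschitz_continuous_map_def Z mspace_submetric mdist_submetric
      using E'E fE by (auto simp: d_def intro!: exI[of _ 1])
    moreover have "Lipschitz_continuous_map (submetric Y (f ` E)) Z g"
      unfolding Lipschitz_continuous_map_def Z mspace_submetric mdist_submetric
      using fg by (auto simp: d_def E'_def intro!: exI[of _ 1])
    ultimately have "homeomorphic_maps (mtopology_of Z) (mtopology_of (submetric Y (f ` E))) f g"
      using Z fg fE E'_def unfolding homeomorphic_maps_def
      by (auto intro!: Lipschitz_continuous_imp_continuous_map)
    then show ?thesis unfolding homeomorphic_space_def by blast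
  qed
  ultimately show ?thesis using D_dim_homeomorphic by metis
qed

end

theory Submission
  imports Defs
begin

text \<open>Lipschitz maps compose. A Lipschitz map \<open>g\<close> on a subspace \<open>E\<close>
  of the image of \<open>f\<close> pulls back to the Lipschitz map \<open>g \<circ> f\<close> on the
  preimage of \<open>E\<close>, and both have the same image. Hence each value entering the supremum
  for the image is bounded by the supremum for \<open>X\<close>. In the bi-Lipschitz case this
  inequality, applied to \<open>f\<close> and to its inverse, gives equality by
  antisymmetry.\<close>

lemma t_DHD_Lipschitz_image_le:
  fixes X :: "'a metric" and Y :: "'b metric"
  assumes f: "Lipschitz_continuous_map X Y f"
  shows "(t_DHD (submetric Y (f ` mspace X)) :: 'o::wellorder tdim) \<le> t_DHD X"
  unfolding t_DHD_def[of "submetric Y (f ` mspace X)"]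
proof (rule tdim_sup_least, clarsimp)
  fix E and Z :: "'b metric" and g
  assume E: "E \<subseteq> f ` mspace X" "E \<subseteq> mspace Y"
    and g: "Lipschitz_continuous_map (submetric Y (f ` mspace X \<inter> E)) Z g"
  \<comment> \<open>\<open>E\<close> lies in the image of \<open>f\<close>, so \<open>f\<close> maps
    its full preimage onto \<open>E\<close>; this is why composing with \<open>f\<close> leaves the
    image of \<open>g\<close> unchanged.\<close>
  define E' where "E' = {x \<in> mspace X. f x \<in> E}"
  have img: "f ` E' = E" using E by (auto simp: E'_def)
  have "Lipschitz_continuous_map (submetric X E') (submetric Y E) f"
    using f img Lipschitz_continuous_map_from_submetric
    by (auto simp: Lipschitz_continuous_map_into_submetric)
  moreover have "Lipschitz_continuous_map (submetric Y E) Z g"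
    using g E(1) by (simp add: Int_absorb1)
  ultimately have "Lipschitz_continuous_map (submetric X E') Z (g \<circ> f)"
    by (rule Lipschitz_continuous_map_compose)
  moreover have "E' \<subseteq> mspace X" by (auto simp: E'_def)
  \<comment> \<open>The points of \<open>Z\<close> have type \<open>'b\<close>, while
    \<open>t_DHD X\<close> is a supremum over targets with points in \<open>'a\<close>;
    \<open>D_dim_Lipschitz_image_le\<close> bridges the two types.\<close>
  ultimately have "D_dim (mtopology_of (submetric Z ((g \<circ> f) ` E'))) \<le> (t_DHD X :: 'o tdim)"
    by (intro D_dim_Lipschitz_image_le)
  then show "D_dim (mtopology_of (submetric Z (g ` E))) \<le> (t_DHD X :: 'o tdim)"
    by (simp only: image_comp[symmetric] img)
qed

theorem theorem3p3:
  fixes X :: "'a metric" and Y :: "'b metric" and f :: "'a \<Rightarrow> 'b"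
  assumes "Lipschitz_continuous_map X Y f"
  shows "(t_DHD (submetric Y (f ` mspace X)) :: ('a, 'b) dim_ordinal tdim) \<le> t_DHD X \<and>
         (bi_Lipschitz_map X Y f \<longrightarrow> (t_DHD Y :: ('a, 'b) dim_ordinal tdim) = t_DHD X)"
proof (intro conjI impI)
  show "(t_DHD (submetric Y (f ` mspace X)) :: ('a, 'b) dim_ordinal tdim) \<le> t_DHD X"
    using assms by (rule t_DHD_Lipschitz_image_le)
next
  assume "bi_Lipschitz_map X Y f"
  then have bij: "bij_betw f (mspace X) (mspace Y)"
    and inv: "Lipschitz_continuous_map Y X (inv_into (mspace X) f)"
    by (auto simp: bi_Lipschitz_map_def)
  \<comment> \<open>Surjectivity turns the image subspace in the general inequality into the whole
    space.\<close>
  have "inv_into (mspace X) f ` mspace Y = mspace X"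
    using bij_betw_inv_into[OF bij] by (rule bij_betw_imp_surj_on)
  with t_DHD_Lipschitz_image_le[OF inv]
  have "(t_DHD X :: ('a, 'b) dim_ordinal tdim) \<le> t_DHD Y"
    by (simp add: submetric_mspace)
  moreover have "(t_DHD Y :: ('a, 'b) dim_ordinal tdim) \<le> t_DHD X"
    using t_DHD_Lipschitz_image_le[OF assms] bij_betw_imp_surj_on[OF bij]
    by (simp add: submetric_mspace)
  ultimately show "(t_DHD Y :: ('a, 'b) dim_ordinal tdim) = t_DHD X"
    by simp
qed

end
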